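(* Consider the discrete-time linear system $x_{k+1}=A_kx_k+B_ku_k$, $k=0,\dots,N-1$, with $x_k\in\mathbb{R}^{n_x}$, $u_k\in\mathbb{R}^{n_u}$, and initial state $x_0\sim\mathrm{GMM}(\alpha_i,\mu_0^i,\Sigma_0^i)_{i=1:K}$ with each $\Sigma_0^i\succ0$. Let $v_k\in\mathbb{R}^{n_u}$ and $L_k^i\in\mathbb{R}^{n_u\times n_x}$ ($k=0,\dots,N-1$, $i=1,\dots,K$) be arbitrary, and let the control be generated by the randomized affine policy described in the context. Then for every $k=0,1,\dots,N$ the state is distributed as a Gaussian mixture, $x_k\sim\mathrm{GMM}(\alpha_i,\mu_k^i,\Sigma_k^i)_{i=1:K}$, where $$\mu_k^i=E_k\big[A\mu_0^i+BV+BL^i(\mu_0^i-\mu_0^g)\big],\qquad \Sigma_k^i=E_k(A+BL^i)\Sigma_0^i(A+BL^i)^\top E_k^\top .$$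
   Context: Gaussian mixtures: for weights $\alpha_i\ge0$ with $\sum_{i=1}^K\alpha_i=1$, $x\sim\mathrm{GMM}(\alpha_i,\mu_i,\Sigma_i)_{i=1:K}$ means that the law of $x$ is $\sum_{i=1}^K\alpha_i\,\mathcal N(\mu_i,\Sigma_i)$, where $\mathcal N(\mu,\Sigma)$ is the (possibly degenerate, $\Sigma\succeq0$) Gaussian law. $f_{\mathcal N}(\cdot;\mu,\Sigma)$ is the Gaussian density for $\Sigma\succ0$. Policy: let $\mu_0^g=\mathbb{E}[x_0]=\sum_{i=1}^K\alpha_i\mu_0^i$ and $$\lambda_i(x)=\frac{\alpha_i f_{\mathcal N}(x;\mu_0^i,\Sigma_0^i)}{\sum_{j=1}^K\alpha_jf_{\mathcal N}(x;\mu_0^j,\Sigma_0^j)}.$$ After $x_0$ is observed, a single random index $I\in\{1,\dots,K\}$ is drawn with $\mathbb{P}[I=i\mid x_0]=\lambda_i(x_0)$, and the control is $u_k=v_k+L_k^{I}(x_0-\mu_0^g)$ for all $k=0,\dots,N-1$ (the same index $I$ is used at all times). Stacked notation: $X=[x_0^\top,\dots,x_N^\top]^\top$, $U=[u_0^\top,\dots,u_{N-1}^\top]^\top$, $V=[v_0^\top,\dots,v_{N-1}^\top]^\top$, $L^i=[(L_0^i)^\top,\dots,(L_{N-1}^i)^\top]^\top$. $A$ and $B$ are the block matrices such that $X=Ax_0+BU$ is the solution of the system: the $k$-th block row ($k=0,\dots,N$) of $A$ is $A_{k-1}\cdots A_0$ (identity for $k=0$), and the $(k,l)$ block of $B$ ($l=0,\dots,N-1$)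 is $A_{k-1}\cdots A_{l+1}B_l$ if $l<k$ (equal to $B_{k-1}$ if $l=k-1$) and $0$ otherwise. $E_k$ is the block selection matrix with $x_k=E_kX$. *)

theory Defs
  imports "HOL-Probability.Probability"
begin

section \<open>Gaussian laws and Gaussian mixtures\<close>

definition pos_semidef :: "real^'n^'n \<Rightarrow> bool" where
  "pos_semidef S \<longleftrightarrow> transpose S = S \<and> (\<forall>x. 0 \<le> x \<bullet> (S *v x))"

definition pos_def :: "real^'n^'n \<Rightarrow> bool" where
  "pos_def S \<longleftrightarrow> transpose S = S \<and> (\<forall>x. x \<noteq> 0 \<longrightarrow> 0 < x \<bullet> (S *v x))"

definition std_gaussian :: "(real^'n) measure" where
  "std_gaussian = density lborel (\<lambda>z. ennreal (\<Prod>i\<in>UNIV. std_normal_density (z $ i)))"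

text \<open>
  The possibly degenerate Gaussian law is the law of \<open>\<mu> + R Z\<close>, with \<open>Z\<close> standard Gaussian and
  \<open>R R\<^sup>T = S\<close>. Such an \<open>R\<close> exists iff \<open>S\<close> is positive semidefinite, and the law
  does not depend on which one is chosen. For other \<open>S\<close> the value is meaningless.
\<close>

definition gaussian :: "real^'n \<Rightarrow> real^'n^'n \<Rightarrow> (real^'n) measure" where
  "gaussian \<mu> S =
     distr std_gaussian borel (\<lambda>z. \<mu> + (SOME R :: real^'n^'n. R ** transpose R = S) *v z)"

definition gaussian_density :: "real^'n \<Rightarrow> real^'n^'n \<Rightarrow> real^'n \<Rightarrow> real" where
  "gaussian_density \<mu> S x =
     exp (- ((x - \<mu>) \<bullet> (matrix_inv S *v (x - \<mu>))) / 2) / sqrt ((2 * pi) ^ CARD('n) * det S)"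

definition gmm :: "nat \<Rightarrow> (nat \<Rightarrow> real) \<Rightarrow> (nat \<Rightarrow> real^'n) \<Rightarrow> (nat \<Rightarrow> real^'n^'n) \<Rightarrow> (real^'n) measure"
where
  "gmm K \<alpha> \<mu> S = measure_of UNIV (sets borel)
     (\<lambda>D. \<Sum>i=1..K. ennreal (\<alpha> i) * emeasure (gaussian (\<mu> i) (S i)) D)"

definition has_gmm_law :: "'w measure \<Rightarrow> ('w \<Rightarrow> real^'n) \<Rightarrow> nat \<Rightarrow> (nat \<Rightarrow> real) \<Rightarrow>
    (nat \<Rightarrow> real^'n) \<Rightarrow> (nat \<Rightarrow> real^'n^'n) \<Rightarrow> bool" where
  "has_gmm_law M X K \<alpha> \<mu> S \<longleftrightarrow>
     (\<forall>i\<in>{1..K}. 0 \<le> \<alpha> i) \<and> (\<Sum>i=1..K. \<alpha> i) = 1 \<and> (\<forall>i\<in>{1..K}. pos_semidef (S i)) \<and>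
     X \<in> borel_measurable M \<and> distr M borel X = gmm K \<alpha> \<mu> S"

definition gmm_mean :: "nat \<Rightarrow> (nat \<Rightarrow> real) \<Rightarrow> (nat \<Rightarrow> real^'n) \<Rightarrow> real^'n" where
  "gmm_mean K \<alpha> \<mu> = (\<Sum>i=1..K. \<alpha> i *\<^sub>R \<mu> i)"

definition gmm_weight :: "nat \<Rightarrow> (nat \<Rightarrow> real) \<Rightarrow> (nat \<Rightarrow> real^'n) \<Rightarrow> (nat \<Rightarrow> real^'n^'n) \<Rightarrow>
    nat \<Rightarrow> real^'n \<Rightarrow> real" where
  "gmm_weight K \<alpha> \<mu> S i x =
     \<alpha> i * gaussian_density (\<mu> i) (S i) x / (\<Sum>j=1..K. \<alpha> j * gaussian_density (\<mu> j) (S j) x)"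


section \<open>Stacked system matrices\<close>

text \<open>
  Stacked objects are families of blocks indexed by time: a block column \<open>F\<close> has blocks \<open>F j\<close>,
  a block row \<open>E\<close> has blocks \<open>E j\<close>, and a block matrix \<open>G\<close> has blocks \<open>G j l\<close>. States have block
  indices \<open>0, \<dots>, N\<close> and controls \<open>0, \<dots>, N - 1\<close>; the number \<open>p\<close> of blocks summed over is explicit
  in the products below. In particular \<open>V\<close> is the family \<open>v\<close> itself, and \<open>L\<^sup>i\<close> is \<open>\<lambda>l. L l i\<close>.
\<close>

definition block_mat_vec :: "nat \<Rightarrow> (nat \<Rightarrow> nat \<Rightarrow> real^'b^'a) \<Rightarrow> (nat \<Rightarrow> real^'b) \<Rightarrow> (nat \<Rightarrow> real^'a)"
where
  "block_mat_vec p G x = (\<lambda>j. \<Sum>l<p. G j l *v x l)"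

definition block_mat_col :: "nat \<Rightarrow> (nat \<Rightarrow> nat \<Rightarrow> real^'b^'a) \<Rightarrow> (nat \<Rightarrow> real^'c^'b) \<Rightarrow> (nat \<Rightarrow> real^'c^'a)"
where
  "block_mat_col p G F = (\<lambda>j. \<Sum>l<p. G j l ** F l)"

definition block_row_vec :: "nat \<Rightarrow> (nat \<Rightarrow> real^'b^'a) \<Rightarrow> (nat \<Rightarrow> real^'b) \<Rightarrow> real^'a" where
  "block_row_vec p E x = (\<Sum>j<p. E j *v x j)"

definition block_row_col :: "nat \<Rightarrow> (nat \<Rightarrow> real^'b^'a) \<Rightarrow> (nat \<Rightarrow> real^'c^'b) \<Rightarrow> real^'c^'a" where
  "block_row_col p E F = (\<Sum>j<p. E j ** F j)"

text \<open>Transposition exchanges block rows and block columns.\<close>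

definition block_transpose :: "(nat \<Rightarrow> real^'b^'a) \<Rightarrow> (nat \<Rightarrow> real^'a^'b)" where
  "block_transpose F = (\<lambda>j. transpose (F j))"

text \<open>\<open>transition A l k\<close> is the product \<open>A (k - 1) ** \<dots> ** A l\<close>, the identity if \<open>k \<le> l\<close>.\<close>

fun transition :: "(nat \<Rightarrow> real^'n^'n) \<Rightarrow> nat \<Rightarrow> nat \<Rightarrow> real^'n^'n" where
  "transition A l 0 = mat 1"
| "transition A l (Suc k) = (if l \<le> k then A k ** transition A l k else mat 1)"

definition stacked_A :: "(nat \<Rightarrow> real^'n^'n) \<Rightarrow> nat \<Rightarrow> real^'n^'n" where
  "stacked_A A = (\<lambda>k. transition A 0 k)"

definition stacked_B :: "(nat \<Rightarrow> real^'n^'n) \<Rightarrow> (nat \<Rightarrow> real^'m^'n) \<Rightarrow> nat \<Rightarrow> nat \<Rightarrow> real^'m^'n" where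
  "stacked_B A B = (\<lambda>k l. if l < k then transition A (Suc l) k ** B l else 0)"

definition block_sel :: "nat \<Rightarrow> nat \<Rightarrow> real^'n^'n" where
  "block_sel k = (\<lambda>j. if j = k then mat 1 else 0)"

text \<open>The block column \<open>A + B L\<close>, for a block column \<open>L\<close> of gains.\<close>

definition closed_loop :: "nat \<Rightarrow> (nat \<Rightarrow> real^'n^'n) \<Rightarrow> (nat \<Rightarrow> real^'m^'n) \<Rightarrow>
    (nat \<Rightarrow> real^'n^'m) \<Rightarrow> nat \<Rightarrow> real^'n^'n" where
  "closed_loop N A B L = (\<lambda>j. stacked_A A j + block_mat_col N (stacked_B A B) L j)"

definition state_mean :: "nat \<Rightarrow> (nat \<Rightarrow> real^'n^'n) \<Rightarrow> (nat \<Rightarrow> real^'m^'n) \<Rightarrow> (nat \<Rightarrow> real^'m) \<Rightarrow>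
    (nat \<Rightarrow> real^'n^'m) \<Rightarrow> real^'n \<Rightarrow> real^'n \<Rightarrow> nat \<Rightarrow> real^'n" where
  "state_mean N A B v L \<mu> \<mu>g k =
     block_row_vec (N + 1) (block_sel k)
       (\<lambda>j. stacked_A A j *v \<mu> + block_mat_vec N (stacked_B A B) v j
            + block_mat_col N (stacked_B A B) L j *v (\<mu> - \<mu>g))"

definition state_cov :: "nat \<Rightarrow> (nat \<Rightarrow> real^'n^'n) \<Rightarrow> (nat \<Rightarrow> real^'m^'n) \<Rightarrow>
    (nat \<Rightarrow> real^'n^'m) \<Rightarrow> real^'n^'n \<Rightarrow> nat \<Rightarrow> real^'n^'n" where
  "state_cov N A B L S k =
     block_row_col (N + 1) (block_sel k) (closed_loop N A B L) ** S **
     block_row_col (N + 1) (block_transpose (closed_loop N A B L)) (block_transpose (block_sel k))"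

end

theory Submission imports Defs begin

text \<open>
  Conditionally on \<open>I = i\<close> the initial state has law \<open>N(\<mu>\<^sub>0\<^sup>i, \<Sigma>\<^sub>0\<^sup>i)\<close>, and \<open>P(I = i) = \<alpha>\<^sub>i\<close>:
  the mixture density of \<open>x\<^sub>0\<close> is the denominator of \<open>\<lambda>\<^sub>i\<close>, so integrating \<open>\<lambda>\<^sub>i\<close> against it leaves
  \<open>\<alpha>\<^sub>i\<close> times the \<open>i\<close>-th Gaussian density. On \<open>I = i\<close> the state \<open>x\<^sub>k\<close> is the affine function
  \<open>\<mu>\<^sub>k\<^sup>i + E\<^sub>k (A + B L\<^sup>i) (x\<^sub>0 - \<mu>\<^sub>0\<^sup>i)\<close> of \<open>x\<^sub>0\<close>. The image of a Gaussian law under such a map is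
  the law \<open>gaussian\<close> assigns to the new covariance because two factors of one
  covariance matrix differ by an orthogonal matrix, which leaves the standard Gaussian invariant.
\<close>

section \<open>Factors of covariance matrices\<close>

text \<open>Gram-Schmidt for the inner product \<open>a \<bullet> (S *v b)\<close>, by induction
  over the set of indices already served. The family is indexed by the type \<open>'n\<close> itself
  so that it can be used directly as the rows of a square matrix.\<close>

lemma pos_def_orthonormal_family:
  fixes S :: "real^'n^'n"
  assumes "pos_def S"
  shows "\<exists>w :: 'n \<Rightarrow> real^'n. \<forall>i j. w i \<bullet> (S *v w j) = (if i = j then 1 else 0)"
proof -
  have sym: "a \<bullet> (S *v b) = b \<bullet> (S *v a)" for a b
    using assms by (metis dot_lmul_matrix inner_commute pos_def_def vector_transpose_matrix)
  have pos: "0 < a \<bullet> (S *v a)" if "a \<noteq> 0" for a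
    using assms that by (auto simp: pos_def_def)
  have "\<exists>w :: 'n \<Rightarrow> real^'n. \<forall>i\<in>J. \<forall>j\<in>J. w i \<bullet> (S *v w j) = (if i = j then 1 else 0)"
    if "finite J" for J :: "'n set"
    using that
  proof (induction J)
    case empty
    show ?case by simp
  next
    case (insert k J)
    then obtain w :: "'n \<Rightarrow> real^'n"
      where w: "\<And>i j. i \<in> J \<Longrightarrow> j \<in> J \<Longrightarrow> w i \<bullet> (S *v w j) = (if i = j then 1 else 0)" by blast
    \<comment> \<open>Fewer than \<open>CARD('n)\<close> vectors cannot span the space, so some
      \<open>z\<close> remains to be orthogonalised and normalised.\<close>
    have "dim (w ` J) \<le> card (w ` J)"
      using insert.hyps by (intro dim_le_card') simp
    also have "\<dots> \<le> card J" using insert.hyps by (simp add: card_image_le)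
    also have "\<dots> < CARD('n)" using insert.hyps
      by (metis UNIV_I card_mono card_insert_disjoint finite subset_UNIV Suc_le_eq)
    finally have "span (w ` J) \<noteq> UNIV"
      by (metis dim_UNIV dim_span nat_neq_iff DIM_cart DIM_real mult.right_neutral)
    then obtain z where z: "z \<notin> span (w ` J)" by blast
    define y where "y = z - (\<Sum>j\<in>J. (w j \<bullet> (S *v z)) *\<^sub>R w j)"
    have "y \<noteq> 0"
    proof
      assume "y = 0"
      then have "z = (\<Sum>j\<in>J. (w j \<bullet> (S *v z)) *\<^sub>R w j)" by (simp add: y_def)
      also have "\<dots> \<in> span (w ` J)" by (intro span_sum span_scale span_base imageI)
      finally show False using z by contradiction
    qed
    have orth: "w i \<bullet> (S *v y) = 0" if "i \<in> J" for i
    proof -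
      have "w i \<bullet> (S *v y) =
          w i \<bullet> (S *v z) - (\<Sum>j\<in>J. (w j \<bullet> (S *v z)) * (w i \<bullet> (S *v w j)))"
        by (simp add: y_def matrix_vector_mult_diff_distrib linear_sum[OF matrix_vector_mul_linear]
            matrix_vector_mult_scaleR inner_diff_right inner_sum_right)
      also have "(\<Sum>j\<in>J. (w j \<bullet> (S *v z)) * (w i \<bullet> (S *v w j))) =
          (\<Sum>j\<in>J. if i = j then w j \<bullet> (S *v z) else 0)"
        using that by (intro sum.cong) (auto simp: w)
      finally show ?thesis using that insert.hyps by simp
    qed
    define e where "e = (1 / sqrt (y \<bullet> (S *v y))) *\<^sub>R y"
    have ee: "e \<bullet> (S *v e) = 1"
      using pos[OF \<open>y \<noteq> 0\<close>] by (simp add: e_def matrix_vector_mult_scaleR field_simps)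
    have we: "w i \<bullet> (S *v e) = 0" if "i \<in> J" for i
      using orth[OF that] by (simp add: e_def matrix_vector_mult_scaleR)
    have ew: "e \<bullet> (S *v w i) = 0" if "i \<in> J" for i
      using we[OF that] sym[of e "w i"] by (rule trans[rotated])
    have "\<forall>i\<in>insert k J. \<forall>j\<in>insert k J.
        (w(k := e)) i \<bullet> (S *v (w(k := e)) j) = (if i = j then 1 else 0)"
      using insert.hyps w ee we ew by auto
    then show ?case by blast
  qed
  from this[OF finite[of UNIV]] show ?thesis by auto
qed

text \<open>Let \<open>P\<close> have the orthonormal vectors as its rows. Orthonormality reads
  \<open>P ** S ** transpose P = mat 1\<close>, so \<open>R = S ** transpose P\<close> is the
  inverse of \<open>P\<close>. Symmetry gives \<open>transpose R = P ** S\<close>, hence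
  \<open>R ** transpose R = (R ** P) ** S = S\<close>.\<close>

lemma pos_def_factor:
  fixes S :: "real^'n^'n"
  assumes "pos_def S"
  shows "\<exists>R :: real^'n^'n. R ** transpose R = S"
proof -
  obtain w :: "'n \<Rightarrow> real^'n" where w: "\<And>i j. w i \<bullet> (S *v w j) = (if i = j then 1 else 0)"
    using pos_def_orthonormal_family[OF assms] by blast
  define P :: "real^'n^'n" where "P = (\<chi> i. w i)"
  define R where "R = S ** transpose P"
  have col: "column j R = S *v w j" for j
    by (simp add: R_def P_def column_def matrix_matrix_mult_def matrix_vector_mult_def transpose_def)
  have "(P ** R) $ i $ j = mat 1 $ i $ j" for i j
    using w[of i j] col[of j, symmetric]
    by (simp add: matrix_matrix_mult_def inner_vec_def column_def P_def mat_def)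
  then have "P ** R = mat 1"
    by (simp add: vec_eq_iff)
  then have "R ** P = mat 1"
    by (simp add: matrix_left_right_inverse)
  moreover have "transpose R = P ** S"
    using assms by (simp add: R_def matrix_transpose_mul pos_def_def)
  ultimately have "R ** transpose R = S"
    by (simp add: matrix_mul_assoc)
  then show ?thesis by blast
qed

text \<open>An isometry on \<open>W\<close> is injective there, so \<open>W\<close> and its image
  have equal dimension, and hence so have their orthogonal complements \<open>W1\<close> and
  \<open>W2\<close>. With an isometry \<open>h\<close> from \<open>W1\<close> onto \<open>W2\<close>
  and the orthogonal projection \<open>p\<close> onto \<open>W\<close>, the map \<open>q\<close>
  applies \<open>f\<close> to the projection and \<open>h\<close> to the remainder. Pythagoras shows
  that it preserves norms.\<close>

lemma orthogonal_transformation_extending_isometry: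
  fixes f :: "real^'n \<Rightarrow> real^'n"
  assumes W: "subspace W" and f: "linear f" and norm_f: "\<And>y. y \<in> W \<Longrightarrow> norm (f y) = norm y"
  obtains q where "orthogonal_transformation q" "\<And>y. y \<in> W \<Longrightarrow> q y = f y"
proof -
  define W1 where "W1 = {y. \<forall>x\<in>W. orthogonal x y}"
  define W2 where "W2 = {y. \<forall>x\<in>f ` W. orthogonal x y}"
  have fW: "subspace (f ` W)" by (rule linear_subspace_image[OF f W])
  have sub: "subspace W1" "subspace W2"
    unfolding W1_def W2_def by (rule subspace_orthogonal_to_vectors)+
  have "inj_on f W"
  proof (rule inj_onI)
    fix a b assume "a \<in> W" "b \<in> W" "f a = f b"
    then show "a = b"
      using norm_f[of "a - b"] W by (simp add: linear_diff[OF f] subspace_diff)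
  qed
  then have "dim (f ` W) = dim W"
    using f W by (metis dim_image_eq span_eq_iff)
  moreover have "dim W1 + dim W = DIM(real^'n)" "dim W2 + dim (f ` W) = DIM(real^'n)"
    using dim_subspace_orthogonal_to_vectors[OF W subspace_UNIV]
      dim_subspace_orthogonal_to_vectors[OF fW subspace_UNIV] by (simp_all add: W1_def W2_def)
  ultimately have "dim W1 = dim W2" by linarith
  then obtain h where h: "linear h" "h ` W1 = W2" "\<And>x. x \<in> W1 \<Longrightarrow> norm (h x) = norm x"
    using isometry_subspaces[OF sub] by metis
  obtain Bs where Bs: "Bs \<subseteq> W" "pairwise orthogonal Bs" "\<And>x. x \<in> Bs \<Longrightarrow> norm x = 1"
    "independent Bs" "span Bs = W"
    using orthonormal_basis_subspace[OF W] by metis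
  have finB: "finite Bs" using Bs(4) by (rule independent_imp_finite)
  define p where "p x = (\<Sum>b\<in>Bs. (b \<bullet> x) *\<^sub>R b)" for x
  have lin_p: "linear p"
    unfolding p_def by (intro linear_compose_sum ballI linearI) (simp_all add: algebra_simps)
  have pW: "p x \<in> W" for x
    unfolding p_def using Bs(1) W by (auto intro!: subspace_sum subspace_scale)
  have cW: "x - p x \<in> W1" for x
  proof -
    have "orthogonal (x - p x) b" if "b \<in> Bs" for b
    proof -
      have "p x \<bullet> b = (\<Sum>c\<in>Bs. (c \<bullet> x) * (c \<bullet> b))" by (simp add: p_def inner_sum_left)
      also have "\<dots> = (\<Sum>c\<in>Bs. if c = b then b \<bullet> x else 0)"
      proof (rule sum.cong)
        fix c assume "c \<in> Bs"
        then show "(c \<bullet> x) * (c \<bullet> b) = (if c = b then b \<bullet> x else 0)"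
          using that Bs(2) Bs(3)[of b] by (auto simp: pairwise_def orthogonal_def dot_square_norm)
      qed simp
      also have "\<dots> = b \<bullet> x" using finB that by simp
      finally show ?thesis by (simp add: orthogonal_def inner_diff_left inner_commute[of x])
    qed
    then have "orthogonal (x - p x) y" if "y \<in> W" for y
      using that orthogonal_to_span[of y Bs "x - p x"] Bs(5) by simp
    then show ?thesis by (auto simp: W1_def orthogonal_commute)
  qed
  have p_id: "p y = y" if "y \<in> W" for y
  proof -
    have "y - p y \<in> W" using that pW W by (simp add: subspace_diff)
    with cW[of y] have "orthogonal (y - p y) (y - p y)" by (auto simp: W1_def)
    then show ?thesis by (simp add: orthogonal_def)
  qed
  define q where "q x = f (p x) + h (x - p x)" for x
  have "linear q"
    by (intro linearI) (simp_all add: q_def linear_add[OF lin_p] linear_add[OF f] linear_add[OF h(1)]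
        linear_diff[OF h(1)] linear_cmul[OF lin_p] linear_cmul[OF f] linear_cmul[OF h(1)] algebra_simps)
  moreover have "norm (q x) = norm x" for x
  proof -
    have "orthogonal (f (p x)) (h (x - p x))"
      using h(2) pW[of x] cW[of x] by (auto simp: W2_def)
    then have "(norm (q x))\<^sup>2 = (norm (f (p x)))\<^sup>2 + (norm (h (x - p x)))\<^sup>2"
      by (simp add: q_def norm_add_Pythagorean)
    also have "\<dots> = (norm (p x))\<^sup>2 + (norm (x - p x))\<^sup>2"
      using norm_f[OF pW] h(3)[OF cW] by simp
    also have "\<dots> = (norm (p x + (x - p x)))\<^sup>2"
      using pW[of x] cW[of x] by (intro norm_add_Pythagorean[symmetric]) (auto simp: W1_def)
    finally show ?thesis by simp
  qed
  ultimately have "orthogonal_transformation q" by (simp add: orthogonal_transformation)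
  moreover have "q y = f y" if "y \<in> W" for y
    using p_id[OF that] h(1) by (simp add: q_def linear_0)
  ultimately show thesis by (rule that)
qed

text \<open>The squared norms of \<open>transpose R *v x\<close> and \<open>transpose T *v x\<close>
  are the same quadratic form in \<open>x\<close>. Sending the first vector to the second is
  therefore a well-defined isometry on the range of \<open>transpose R\<close>. It extends to an
  orthogonal map of the whole space, and transposing gives \<open>Q\<close>. Nothing is assumed
  about the rank, so degenerate covariances are covered.\<close>

lemma factors_differ_by_orthogonal_matrix:
  fixes R T :: "real^'n^'n"
  assumes eq: "R ** transpose R = T ** transpose T"
  obtains Q where "orthogonal_matrix Q" "T = R ** Q"
proof -
  let ?r = "(*v) (transpose R)" and ?t = "(*v) (transpose T)"
  have norm_eq: "norm (?r x) = norm (?t x)" for x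
  proof -
    have "(norm (transpose C *v x))\<^sup>2 = x \<bullet> ((C ** transpose C) *v x)" for C :: "real^'n^'n"
      by (simp add: power2_norm_eq_inner flip: matrix_vector_mul_assoc dot_lmul_matrix)
    then have "(norm (?r x))\<^sup>2 = (norm (?t x))\<^sup>2" using eq by simp
    then show ?thesis by simp
  qed
  obtain g where g: "linear g" "\<And>x. ?r (g (?r x)) = ?r x"
    using real_vector.linear_exists_right_inverse_on[OF matrix_vector_mul_linear subspace_UNIV, of "transpose R"]
    by auto
  \<comment> \<open>\<open>g\<close> picks a preimage under \<open>transpose R\<close>. It differs
    from \<open>x\<close> by a kernel vector of \<open>transpose R\<close>, and equality of the
    norms puts this vector in the kernel of \<open>transpose T\<close> too.\<close>
  have ext: "?t (g (?r x)) = ?t x" for x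
    using norm_eq[of "g (?r x) - x"] by (simp add: matrix_vector_mult_diff_distrib g(2) del: transpose_matrix_vector)
  have "linear (\<lambda>y. ?t (g y))"
    using linear_compose[OF g(1) matrix_vector_mul_linear, of "transpose T"] by (simp add: o_def)
  moreover have "norm (?t (g y)) = norm y" if "y \<in> range ?r" for y
    using that ext norm_eq by auto
  ultimately obtain q where q: "orthogonal_transformation q" "\<And>y. y \<in> range ?r \<Longrightarrow> q y = ?t (g y)"
    using orthogonal_transformation_extending_isometry[of "range ?r" "\<lambda>y. ?t (g y)"]
      linear_subspace_image[OF matrix_vector_mul_linear subspace_UNIV] by metis
  have "orthogonal_matrix (matrix q)" and mq: "\<And>x. matrix q *v x = q x"
    using q(1) by (auto simp: orthogonal_transformation_matrix matrix_works)
  moreover have "transpose T *v x = (matrix q ** transpose R) *v x" for x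
    using q(2) ext by (simp add: mq flip: matrix_vector_mul_assoc)
  then have "transpose T = matrix q ** transpose R" by (simp add: matrix_eq)
  then have "T = R ** transpose (matrix q)"
    by (metis matrix_transpose_mul transpose_transpose)
  ultimately show thesis by (intro that[of "transpose (matrix q)"]) simp_all
qed

section \<open>Lebesgue measure under linear maps\<close>

lemma borel_measurable_matrix_vector_mult [measurable]:
  fixes R :: "real^'n^'m"
  shows "(*v) R \<in> borel_measurable borel"
  by (intro borel_measurable_continuous_onI matrix_vector_mult_linear_continuous_on)

lemma lborel_coordinate_scaling:
  fixes c :: "'n::finite \<Rightarrow> real"
  assumes "\<And>i. c i \<noteq> 0"
  shows "lborel = density (distr lborel borel (\<lambda>x :: real^'n. \<chi> i. c i * x $ i)) (\<lambda>_. ennreal \<bar>\<Prod>i\<in>UNIV. c i\<bar>)"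
proof -
  \<comment> \<open>\<open>lborel_affine_euclidean\<close> takes one factor per basis vector,
    whereas \<open>c\<close> has one per index; \<open>d\<close> reads the factor \<open>c i\<close>
    off the vector \<open>axis i 1\<close>.\<close>
  define d :: "real^'n \<Rightarrow> real" where "d b = (\<Sum>i\<in>UNIV. c i * b $ i)" for b
  have d: "d (axis i 1) = c i" for i
    by (simp add: d_def axis_def if_distrib[of "(*) _"] cong: if_cong)
  have B: "(Basis :: (real^'n) set) = (\<lambda>i. axis i 1) ` UNIV"
    by (auto simp: Basis_vec_def)
  have inj: "inj (\<lambda>i :: 'n. axis i (1 :: real))"
    by (simp add: inj_on_def axis_eq_axis)
  have "(\<Sum>j\<in>Basis. (d j * (x \<bullet> j)) *\<^sub>R j) = (\<chi> i. c i * x $ i)" for x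
  proof -
    have "(\<Sum>j\<in>Basis. (d j * (x \<bullet> j)) *\<^sub>R j) = (\<Sum>i\<in>UNIV. (c i * x $ i) *\<^sub>R axis i 1)"
      by (simp add: B sum.reindex[OF inj] d inner_axis)
    then show ?thesis
      by (simp add: vec_eq_iff axis_def if_distrib[of "(*) _"] cong: if_cong)
  qed
  moreover have "(\<Prod>j\<in>Basis. \<bar>d j\<bar>) = \<bar>\<Prod>i\<in>UNIV. c i\<bar>"
    by (simp add: B prod.reindex[OF inj] d abs_prod)
  moreover have "d j \<noteq> 0" if "j \<in> Basis" for j
    using that assms by (auto simp: B d)
  ultimately show ?thesis
    using lborel_affine_euclidean[of d 0] by simp
qed

text \<open>The preimage of a box is the box with permuted sides, which has the same volume, and
  volumes of boxes determine \<open>lborel\<close>.\<close>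

lemma lborel_permute_coordinates:
  fixes p :: "'n::finite \<Rightarrow> 'n"
  assumes p: "bij p"
  shows "lborel = distr lborel borel (\<lambda>x :: real^'n. \<chi> i. x $ p i)"
proof (rule lborel_eqI)
  fix l u :: "real^'n"
  assume le: "\<And>b. b \<in> Basis \<Longrightarrow> l \<bullet> b \<le> u \<bullet> b"
  define q where "q = inv p"
  have pq [simp]: "p (q i) = i" "q (p i) = i" for i
    using p by (simp_all add: q_def bij_is_surj surj_f_inv_f bij_is_inj)
  have B: "(Basis :: (real^'n) set) = (\<lambda>i. axis i 1) ` UNIV"
    by (auto simp: Basis_vec_def)
  have inj: "inj (\<lambda>i :: 'n. axis i (1 :: real))"
    by (simp add: inj_on_def axis_eq_axis)
  have meas: "(\<lambda>x :: real^'n. \<chi> i. x $ p i) \<in> borel_measurable borel"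
    by (intro borel_measurable_continuous_onI continuous_intros)
  have "(\<lambda>x. \<chi> i. x $ p i) -` box l u = box (\<chi> i. l $ q i) (\<chi> i. u $ q i)"
    by (auto simp: mem_box_cart) (metis pq)+
  moreover have "l $ i \<le> u $ i" for i
    using le[of "axis i 1"] by (simp add: inner_axis)
  moreover have "(\<Prod>i\<in>UNIV. u $ q i - l $ q i) = (\<Prod>i\<in>UNIV. u $ i - l $ i)"
    using p by (intro prod.reindex_bij_betw) (simp add: q_def bij_imp_bij_inv)
  ultimately show "emeasure (distr lborel borel (\<lambda>x. \<chi> i. x $ p i)) (box l u) = (\<Prod>b\<in>Basis. (u - l) \<bullet> b)"
    using meas by (simp add: emeasure_distr emeasure_lborel_box_eq B prod.reindex[OF inj] inner_axis)
qed simp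

text \<open>A shear preserves the volume of closed boxes. Linearity carries this over to all
  measurable sets, in particular to the open boxes that determine \<open>lborel\<close>.\<close>

lemma lborel_shear:
  fixes m n :: "'n::finite"
  assumes mn: "m \<noteq> n"
  defines "f \<equiv> \<lambda>x :: real^'n. \<chi> i. if i = m then x $ m + x $ n else x $ i"
  shows "lborel = distr lborel borel f"
proof -
  define g where "g = (\<lambda>x :: real^'n. \<chi> i. if i = m then x $ m - x $ n else x $ i)"
  have fg: "f (g x) = x" "g (f x) = x" for x
    using mn by (simp_all add: f_def g_def vec_eq_iff)
  have lin: "linear f" "linear g"
    by (auto intro!: linearI simp: f_def g_def vec_eq_iff algebra_simps)
  have cont: "continuous_on UNIV f" "continuous_on UNIV g"
    using lin by (simp_all add: linear_continuous_on linear_linear)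
  then have [measurable]: "f \<in> borel_measurable borel" "g \<in> borel_measurable borel"
    by (simp_all add: borel_measurable_continuous_onI)
  have cbox: "measure lebesgue (f ` cbox a b) = measure lebesgue (cbox a b)" for a b
  proof (cases "cbox a b = {}")
    case False
    \<comment> \<open>Translating along axis \<open>n\<close> makes the \<open>n\<close>-th
      coordinate of the lower corner zero, which meets the sign condition of
      \<open>measure_shear_interval\<close>. The shear of the translated box is a translate of the
      sheared box.\<close>
    define t :: "real^'n" where "t = axis n (a $ n)"
    have eq: "f ` cbox a b = (+) (f t) ` f ` cbox (a - t) (b - t)"
      using cbox_translation[of t "a - t" "b - t"]
      by (simp add: linear_add[OF lin(1)] image_comp o_def)
    have "cbox (a - t) (b - t) \<noteq> {}"
      using False by (simp add: interval_ne_empty_cart)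
    then have "measure lebesgue (f ` cbox (a - t) (b - t)) = measure lebesgue (cbox (a - t) (b - t))"
      unfolding f_def using mn by (intro measure_shear_interval) (simp_all add: t_def axis_def)
    moreover have "measure lebesgue (cbox a b) = measure lebesgue (cbox (a - t) (b - t))"
      using cbox_translation[of t "a - t" "b - t"] measure_translation[of t "cbox (a - t) (b - t)"] by simp
    ultimately show ?thesis
      unfolding eq measure_translation by simp
  qed simp
  \<comment> \<open>The inverse shear comes first because preimages under \<open>g\<close> are
    images under \<open>f\<close>, whose measure is known. Pushing the resulting identity forward by
    \<open>f\<close> then gives the claim.\<close>
  have "lborel = distr lborel borel g"
  proof (rule lborel_eqI)
    fix l u :: "real^'n"
    assume le: "\<And>b. b \<in> Basis \<Longrightarrow> l \<bullet> b \<le> u \<bullet> b"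
    have eq: "g -` box l u = f ` box l u"
      using fg by (auto simp: image_iff) metis
    have sets: "f ` box l u \<in> sets borel"
      using measurable_sets[of g borel borel "box l u"] eq by simp
    \<comment> \<open>A linear map that multiplies the measure of every closed box by one constant
      does so for every measurable set; here the constant is 1.\<close>
    have lm: "f ` box l u \<in> lmeasurable" "measure lebesgue (f ` box l u) = measure lebesgue (box l u)"
      using measure_linear_sufficient[OF lin(1), of "box l u" 1] cbox by simp_all
    have "emeasure lborel (f ` box l u) = emeasure lebesgue (f ` box l u)"
      using sets by simp
    also have "\<dots> = ennreal (measure lebesgue (box l u))"
      by (simp only: emeasure_eq_measure2[OF lm(1)] lm(2))
    finally show "emeasure (distr lborel borel g) (box l u) = (\<Prod>b\<in>Basis. (u - l) \<bullet> b)"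
      using le by (simp add: emeasure_distr eq measure_lborel_box_eq)
  qed simp
  then have "distr lborel borel f = distr (distr lborel borel g) borel f" by (rule arg_cong)
  also have "\<dots> = lborel"
    by (simp add: distr_distr comp_def fg distr_id2)
  finally show ?thesis by simp
qed

text \<open>The library proves the change of variables formula only for vectors indexed by a well-ordered type.\<close>

lemma lborel_linear:
  fixes R :: "real^'n^'n"
  assumes "det R \<noteq> 0"
  shows "lborel = density (distr lborel borel ((*v) R)) (\<lambda>_. ennreal \<bar>det R\<bar>)"
proof -
  \<comment> \<open>Induction over elementary linear maps, which include maps with a vanishing
    coordinate. The determinant condition stays inside the induction formula: it excludes those maps
    through a zero row, and by multiplicativity it passes from a composition to both
    factors.\<close>
  have "det (matrix f) \<noteq> 0 \<longrightarrow> lborel = density (distr lborel borel f) (\<lambda>_. ennreal \<bar>det (matrix f)\<bar>)"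
    if "linear f" for f :: "real^'n \<Rightarrow> real^'n"
  proof (rule induct_linear_elementary[OF that]; (intro impI)?)
    fix f g :: "real^'n \<Rightarrow> real^'n"
    assume lin: "linear f" "linear g"
      and f: "det (matrix f) \<noteq> 0 \<longrightarrow> lborel = density (distr lborel borel f) (\<lambda>_. ennreal \<bar>det (matrix f)\<bar>)"
      and g: "det (matrix g) \<noteq> 0 \<longrightarrow> lborel = density (distr lborel borel g) (\<lambda>_. ennreal \<bar>det (matrix g)\<bar>)"
      and nz: "det (matrix (f \<circ> g)) \<noteq> 0"
    have det: "det (matrix (f \<circ> g)) = det (matrix f) * det (matrix g)"
      by (simp add: matrix_compose[OF lin(2,1)] det_mul)
    have [measurable]: "f \<in> borel_measurable borel" "g \<in> borel_measurable borel"
      using lin by (simp_all add: borel_measurable_continuous_onI linear_continuous_on linear_linear)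
    have "lborel = density (distr lborel borel f) (\<lambda>_. ennreal \<bar>det (matrix f)\<bar>)"
      using f nz det by (metis mult_eq_0_iff)
    also have "\<dots> = density (distr (density (distr lborel borel g) (\<lambda>_. ennreal \<bar>det (matrix g)\<bar>)) borel f)
        (\<lambda>_. ennreal \<bar>det (matrix f)\<bar>)"
      using g nz det by (metis mult_eq_0_iff)
    also have "\<dots> = density (distr lborel borel (f \<circ> g)) (\<lambda>_. ennreal \<bar>det (matrix (f \<circ> g))\<bar>)"
      by (simp add: density_distr distr_distr density_density_eq det abs_mult ennreal_mult mult.commute)
    finally show "lborel = \<dots>" .
  next
    fix f :: "real^'n \<Rightarrow> real^'n" and i
    assume "linear f" "\<And>x. f x $ i = 0" and nz: "det (matrix f) \<noteq> 0"
    then have "row i (matrix f) = 0" by (simp add: row_def matrix_def vec_eq_iff)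
    with nz show "lborel = density (distr lborel borel f) (\<lambda>_. ennreal \<bar>det (matrix f)\<bar>)"
      by (simp add: det_zero_row)
  next
    fix c :: "'n \<Rightarrow> real"
    let ?f = "\<lambda>x. \<chi> i. c i * x $ i"
    assume nz: "det (matrix ?f) \<noteq> 0"
    have "det (matrix ?f) = (\<Prod>i\<in>UNIV. matrix ?f $ i $ i)"
      by (rule det_diagonal) (simp add: matrix_def axis_def)
    then have det: "det (matrix ?f) = (\<Prod>i\<in>UNIV. c i)"
      by (simp add: matrix_def axis_def)
    then have "c i \<noteq> 0" for i using nz by simp
    then show "lborel = density (distr lborel borel ?f) (\<lambda>_. ennreal \<bar>det (matrix ?f)\<bar>)"
      unfolding det by (rule lborel_coordinate_scaling)
  next
    fix m n :: 'n
    let ?p = "Transposition.transpose m n"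
    let ?f = "\<lambda>x :: real^'n. \<chi> i. x $ ?p i"
    \<comment> \<open>A swap of coordinates is orthogonal, so its determinant has absolute value
      1.\<close>
    have "?f x \<bullet> ?f y = x \<bullet> y" for x y
      unfolding inner_vec_def using sum.reindex_bij_betw[of ?p UNIV UNIV "\<lambda>i. x $ i \<bullet> y $ i"] by simp
    then have "orthogonal_transformation ?f"
      by (simp add: orthogonal_transformation_def linear_iff vec_eq_iff)
    then show "lborel = density (distr lborel borel ?f) (\<lambda>_. ennreal \<bar>det (matrix ?f)\<bar>)"
      using lborel_permute_coordinates[of ?p, symmetric] by (simp add: density_1)
  next
    fix m n :: 'n
    let ?f = "\<lambda>x :: real^'n. \<chi> i. if i = m then x $ m + x $ n else x $ i"
    assume "m \<noteq> n"
    \<comment> \<open>The matrix of a shear arises from the identity by a row operation, so its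
      determinant is 1.\<close>
    have "matrix ?f = (\<chi> k. if k = m then row m (mat 1) + 1 *s row n (mat 1) else row k (mat 1))"
      by (auto simp: matrix_def row_def mat_def axis_def vec_eq_iff)
    then have "det (matrix ?f) = 1"
      using det_row_operation[OF \<open>m \<noteq> n\<close>, where c = 1 and A = "mat 1 :: real^'n^'n"] by simp
    then show "lborel = density (distr lborel borel ?f) (\<lambda>_. ennreal \<bar>det (matrix ?f)\<bar>)"
      using lborel_shear[OF \<open>m \<noteq> n\<close>, symmetric] by (simp add: density_1)
  qed
  from this[OF matrix_vector_mul_linear, of R] assms show ?thesis
    unfolding matrix_of_matrix_vector_mul by blast
qed

text \<open>Change of variables with a general density. It yields both the rotation invariance of
  the standard Gaussian and the densities of its affine images.\<close>

lemma density_lborel_affine: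
  fixes R :: "real^'n^'n"
  assumes R: "det R \<noteq> 0" and f [measurable]: "f \<in> borel_measurable borel"
  shows "density lborel f =
    distr (density lborel (\<lambda>z. ennreal \<bar>det R\<bar> * f (\<mu> + R *v z))) borel (\<lambda>z. \<mu> + R *v z)"
proof -
  have "lborel = distr lborel borel ((+) \<mu>)"
    by (rule lborel_distr_plus[symmetric])
  also have "\<dots> = distr (density (distr lborel borel ((*v) R)) (\<lambda>_. ennreal \<bar>det R\<bar>)) borel ((+) \<mu>)"
    by (subst lborel_linear[OF R]) simp
  also have "\<dots> = distr (density lborel (\<lambda>_. ennreal \<bar>det R\<bar>)) borel (\<lambda>z. \<mu> + R *v z)"
    by (simp add: density_distr distr_distr o_def)
  finally have "density lborel f =
      density (distr (density lborel (\<lambda>_. ennreal \<bar>det R\<bar>)) borel (\<lambda>z. \<mu> + R *v z)) f" by simp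
  then show ?thesis
    by (simp add: density_distr density_density_eq)
qed

section \<open>The standard Gaussian law, its rotations and its affine images\<close>

lemma prod_std_normal_density:
  fixes z :: "real^'n"
  shows "(\<Prod>i\<in>UNIV. std_normal_density (z $ i)) = exp (- (z \<bullet> z) / 2) / sqrt ((2 * pi) ^ CARD('n))"
proof -
  have "(\<Prod>i\<in>(UNIV :: 'n set). std_normal_density (z $ i)) =
      (1 / sqrt (2 * pi)) ^ CARD('n) * exp (\<Sum>i\<in>UNIV. - (z $ i)\<^sup>2 / 2)"
    by (simp add: std_normal_density_def prod.distrib exp_sum prod_dividef power_divide)
  also have "(\<Sum>i\<in>UNIV. - (z $ i)\<^sup>2 / 2) = - (z \<bullet> z) / 2"
    by (simp add: inner_vec_def power2_eq_square sum_negf flip: sum_divide_distrib)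
  finally show ?thesis
    unfolding real_sqrt_power power_one_over by (simp add: field_simps)
qed

text \<open>The density depends on \<open>z\<close> only through \<open>z \<bullet> z\<close>, and
  the Jacobian factor of \<open>Q\<close> is 1.\<close>

lemma std_gaussian_orthogonal:
  fixes Q :: "real^'n^'n"
  assumes Q: "orthogonal_matrix Q"
  shows "distr std_gaussian borel ((*v) Q) = std_gaussian"
proof -
  have d: "\<bar>det Q\<bar> = 1" using det_orthogonal_matrix[OF Q] by auto
  have "(Q *v z) \<bullet> (Q *v z) = z \<bullet> z" for z
    using Q by (metis dot_lmul_matrix matrix_vector_mul_assoc matrix_vector_mul_lid
        orthogonal_matrix_def transpose_matrix_vector)
  then show ?thesis
    using density_lborel_affine[of Q "\<lambda>z. ennreal (\<Prod>i\<in>UNIV. std_normal_density (z $ i))" 0] d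
    by (simp add: std_gaussian_def prod_std_normal_density)
qed

lemma sets_std_gaussian [simp, measurable_cong]: "sets std_gaussian = sets borel"
  by (simp add: std_gaussian_def)

lemma sets_gaussian [simp, measurable_cong]: "sets (gaussian \<mu> S) = sets borel"
  by (simp add: gaussian_def)

lemma matrix_inv_right:
  fixes S :: "real^'n^'n"
  assumes "det S \<noteq> 0"
  shows "S ** matrix_inv S = mat 1"
proof -
  have "\<exists>T. S ** T = mat 1 \<and> T ** S = mat 1"
    using assms by (simp add: invertible_def flip: invertible_det_nz)
  then show ?thesis
    unfolding matrix_inv_def by (rule someI2_ex) simp
qed

text \<open>\<open>measure_of\<close> returns the prescribed set function only if that function is
  countably additive. Here this follows from the components by exchanging a finite sum with a
  series.\<close>

lemma emeasure_gmm:
  assumes "D \<in> sets borel"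
  shows "emeasure (gmm K \<alpha> \<mu> S) D = (\<Sum>i=1..K. ennreal (\<alpha> i) * emeasure (gaussian (\<mu> i) (S i)) D)"
  unfolding gmm_def
proof (rule emeasure_measure_of_sigma)
  show "sigma_algebra UNIV (sets (borel :: (real^'a) measure))"
    by (metis sets.sigma_algebra_axioms space_borel)
  show "positive (sets borel) (\<lambda>D. \<Sum>i=1..K. ennreal (\<alpha> i) * emeasure (gaussian (\<mu> i) (S i)) D)"
    by (simp add: positive_def)
  show "countably_additive (sets borel) (\<lambda>D. \<Sum>i=1..K. ennreal (\<alpha> i) * emeasure (gaussian (\<mu> i) (S i)) D)"
  proof (rule countably_additiveI)
    fix F :: "nat \<Rightarrow> (real^'a) set"
    assume F: "range F \<subseteq> sets borel" "disjoint_family F"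
    have "(\<Sum>n. \<Sum>i=1..K. ennreal (\<alpha> i) * emeasure (gaussian (\<mu> i) (S i)) (F n)) =
        (\<Sum>i=1..K. \<Sum>n. ennreal (\<alpha> i) * emeasure (gaussian (\<mu> i) (S i)) (F n))"
      by (intro suminf_sum) simp
    also have "\<dots> = (\<Sum>i=1..K. ennreal (\<alpha> i) * emeasure (gaussian (\<mu> i) (S i)) (\<Union> (range F)))"
      using F by (simp add: suminf_emeasure)
    finally show "(\<Sum>n. \<Sum>i=1..K. ennreal (\<alpha> i) * emeasure (gaussian (\<mu> i) (S i)) (F n)) =
        (\<Sum>i=1..K. ennreal (\<alpha> i) * emeasure (gaussian (\<mu> i) (S i)) (\<Union> (range F)))" .
  qed
qed (use assms in simp)

lemma sets_gmm [simp, measurable_cong]: "sets (gmm K \<alpha> \<mu> S) = sets borel"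
  unfolding gmm_def using sets.sets_measure_of_eq[of borel] by simp

lemma gaussian_density_measurable [measurable]:
  fixes S :: "real^'n^'n"
  shows "gaussian_density \<mu> S \<in> borel_measurable borel"
  unfolding gaussian_density_def by measurable

text \<open>At the point \<open>\<mu> + R *v z\<close> the exponent of
  \<open>gaussian_density\<close> becomes that of the standard Gaussian at \<open>z\<close>, and
  \<open>det S\<close> is the square of \<open>det R\<close>, so its root cancels the Jacobian
  factor.\<close>

lemma distr_std_gaussian_density:
  fixes R S :: "real^'n^'n"
  assumes S: "R ** transpose R = S" and nz: "det S \<noteq> 0"
  shows "distr std_gaussian borel (\<lambda>z. \<mu> + R *v z) = density lborel (gaussian_density \<mu> S)"
proof -
  have det: "det S = (det R)\<^sup>2"
    using S by (metis det_mul det_transpose power2_eq_square)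
  then have R: "det R \<noteq> 0" using nz by simp
  have "\<bar>det R\<bar> * gaussian_density \<mu> S (\<mu> + R *v z) = (\<Prod>i\<in>UNIV. std_normal_density (z $ i))" for z
  proof -
    \<comment> \<open>\<open>w\<close> is the inverse covariance applied to the deviation.
      Cancelling the invertible \<open>R\<close> in \<open>R *v (transpose R *v w) = R *v z\<close>
      gives \<open>transpose R *v w = z\<close>, which turns the quadratic form into
      \<open>z \<bullet> z\<close>.\<close>
    define w where "w = matrix_inv S *v (R *v z)"
    have "S *v w = R *v z"
      unfolding w_def by (metis matrix_inv_right[OF nz] matrix_vector_mul_assoc matrix_vector_mul_lid)
    then have "R *v (transpose R *v w) = R *v z"
      by (simp add: S matrix_vector_mul_assoc del: transpose_matrix_vector)
    then have "transpose R *v w = z"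
      using R by (metis invertible_det_nz inj_matrix_vector_mult injD)
    then have "(R *v z) \<bullet> w = z \<bullet> z"
      by (metis dot_lmul_matrix inner_commute transpose_matrix_vector)
    then have "gaussian_density \<mu> S (\<mu> + R *v z) = exp (- (z \<bullet> z) / 2) / sqrt ((2 * pi) ^ CARD('n) * (det R)\<^sup>2)"
      by (simp add: gaussian_density_def w_def det)
    then show ?thesis
      using R unfolding prod_std_normal_density by (simp add: real_sqrt_mult)
  qed
  then have "ennreal \<bar>det R\<bar> * ennreal (gaussian_density \<mu> S (\<mu> + R *v z)) =
      ennreal (\<Prod>i\<in>UNIV. std_normal_density (z $ i))" for z
    by (metis abs_ge_zero ennreal_mult')
  then show ?thesis
    by (subst density_lborel_affine[OF R, where \<mu> = \<mu>]) (simp_all add: std_gaussian_def)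
qed

section \<open>Mixtures and affine images\<close>

text \<open>Removes the choice made by \<open>SOME\<close>: any factor is the chosen one times an
  orthogonal matrix, and the standard Gaussian absorbs that matrix.\<close>

lemma gaussian_eq_affine_image:
  fixes R S :: "real^'n^'n"
  assumes "R ** transpose R = S"
  shows "gaussian \<mu> S = distr std_gaussian borel (\<lambda>z. \<mu> + R *v z)"
proof -
  define R' :: "real^'n^'n" where "R' = (SOME R. R ** transpose R = S)"
  have "R' ** transpose R' = R ** transpose R"
    using someI[of "\<lambda>R. R ** transpose R = S" R] assms by (simp add: R'_def)
  then obtain Q where Q: "orthogonal_matrix Q" "R = R' ** Q"
    using factors_differ_by_orthogonal_matrix by blast
  have "distr std_gaussian borel (\<lambda>z. \<mu> + R *v z) =
      distr (distr std_gaussian borel ((*v) Q)) borel (\<lambda>z. \<mu> + R' *v z)"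
    by (simp add: distr_distr comp_def Q(2) flip: matrix_vector_mul_assoc)
  then show ?thesis
    by (simp add: std_gaussian_orthogonal[OF Q(1)] gaussian_def R'_def)
qed

text \<open>If \<open>R\<close> is a factor of \<open>S\<close>, then \<open>C ** R\<close> is a
  factor of the new covariance. The matrix \<open>C\<close> may be singular, so the argument uses
  factors and not densities.\<close>

lemma gaussian_affine:
  fixes C S :: "real^'n^'n"
  assumes "pos_def S"
  shows "distr (gaussian \<mu> S) borel (\<lambda>x. m + C *v (x - \<mu>)) = gaussian m (C ** S ** transpose C)"
proof -
  obtain R :: "real^'n^'n" where R: "R ** transpose R = S"
    using pos_def_factor[OF assms] by blast
  have CR: "(C ** R) ** transpose (C ** R) = C ** S ** transpose C"
    by (simp add: matrix_transpose_mul matrix_mul_assoc flip: R)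
  show ?thesis
    by (simp add: gaussian_eq_affine_image[OF R] gaussian_eq_affine_image[OF CR] distr_distr comp_def
        matrix_vector_mul_assoc)
qed

text \<open>A factorization makes \<open>det S\<close> a square; definiteness makes \<open>S\<close>
  injective, so the square is not zero.\<close>

lemma pos_def_det:
  fixes S :: "real^'n^'n"
  assumes "pos_def S"
  shows "0 < det S"
proof -
  obtain R :: "real^'n^'n" where "R ** transpose R = S"
    using pos_def_factor[OF assms] by blast
  then have "det S = (det R)\<^sup>2"
    by (metis det_mul det_transpose power2_eq_square)
  moreover have "inj ((*v) S)"
  proof (rule injI)
    fix a b assume "S *v a = S *v b"
    then have "(a - b) \<bullet> (S *v (a - b)) = 0"
      by (simp add: matrix_vector_mult_diff_distrib)
    then show "a = b"
      using assms by (metis eq_iff_diff_eq_0 less_irrefl pos_def_def)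
  qed
  then have "det S \<noteq> 0"
    by (simp add: invertible_left_inverse matrix_left_invertible_injective flip: invertible_det_nz)
  ultimately show ?thesis by simp
qed

lemma gaussian_density_pos:
  assumes "pos_def S"
  shows "0 < gaussian_density \<mu> S x"
  using pos_def_det[OF assms] by (simp add: gaussian_density_def)

lemma gaussian_eq_density:
  assumes "pos_def S"
  shows "gaussian \<mu> S = density lborel (gaussian_density \<mu> S)"
proof -
  obtain R :: "real^'a^'a" where R: "R ** transpose R = S"
    using pos_def_factor[OF assms] by blast
  show ?thesis
    using pos_def_det[OF assms] distr_std_gaussian_density[OF R]
    by (simp add: gaussian_eq_affine_image[OF R])
qed

lemma pos_semidef_congruence:
  fixes C S :: "real^'n^'n"
  assumes "pos_semidef S"
  shows "pos_semidef (C ** S ** transpose C)"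
  unfolding pos_semidef_def
proof
  show "transpose (C ** S ** transpose C) = C ** S ** transpose C"
    using assms by (simp add: pos_semidef_def matrix_transpose_mul matrix_mul_assoc)
  have "x \<bullet> ((C ** S ** transpose C) *v x) = (transpose C *v x) \<bullet> (S *v (transpose C *v x))" for x
    by (metis dot_lmul_matrix matrix_vector_mul_assoc transpose_matrix_vector)
  then show "\<forall>x. 0 \<le> x \<bullet> ((C ** S ** transpose C) *v x)"
    using assms by (simp add: pos_semidef_def)
qed

section \<open>Mixture densities and conditioning on the random index\<close>

lemma gmm_eq_density:
  assumes "\<And>i. i \<in> {1..K} \<Longrightarrow> pos_def (S i)" and "\<And>i. i \<in> {1..K} \<Longrightarrow> 0 \<le> \<alpha> i"
  shows "gmm K \<alpha> \<mu> S = density lborel (\<lambda>x. ennreal (\<Sum>i=1..K. \<alpha> i * gaussian_density (\<mu> i) (S i) x))"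
proof (rule measure_eqI)
  fix D assume "D \<in> sets (gmm K \<alpha> \<mu> S)"
  then have D [measurable]: "D \<in> sets borel" by simp
  have nn: "0 \<le> gaussian_density (\<mu> i) (S i) x" if "i \<in> {1..K}" for i x
    using gaussian_density_pos[OF assms(1)[OF that], of "\<mu> i" x] by simp
  have "emeasure (gmm K \<alpha> \<mu> S) D =
      (\<Sum>i=1..K. ennreal (\<alpha> i) * (\<integral>\<^sup>+x. ennreal (gaussian_density (\<mu> i) (S i) x) * indicator D x \<partial>lborel))"
    unfolding emeasure_gmm[OF D]
    by (intro sum.cong) (simp_all add: gaussian_eq_density assms(1) emeasure_density)
  also have "\<dots> = (\<integral>\<^sup>+x. (\<Sum>i=1..K. ennreal (\<alpha> i) * (ennreal (gaussian_density (\<mu> i) (S i) x) * indicator D x)) \<partial>lborel)"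
    by (subst nn_integral_sum) (simp_all add: nn_integral_cmult)
  also have "\<dots> = (\<integral>\<^sup>+x. ennreal (\<Sum>i=1..K. \<alpha> i * gaussian_density (\<mu> i) (S i) x) * indicator D x \<partial>lborel)"
  proof (rule nn_integral_cong)
    fix x
    have "ennreal (\<Sum>i=1..K. \<alpha> i * gaussian_density (\<mu> i) (S i) x) =
        (\<Sum>i=1..K. ennreal (\<alpha> i) * ennreal (gaussian_density (\<mu> i) (S i) x))"
      using assms(2) nn by (subst sum_ennreal[symmetric]) (auto simp: ennreal_mult intro!: sum.cong)
    then show "(\<Sum>i=1..K. ennreal (\<alpha> i) * (ennreal (gaussian_density (\<mu> i) (S i) x) * indicator D x)) =
        ennreal (\<Sum>i=1..K. \<alpha> i * gaussian_density (\<mu> i) (S i) x) * indicator D x"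
      by (simp add: sum_distrib_right mult.assoc)
  qed
  also have "\<dots> = emeasure (density lborel (\<lambda>x. ennreal (\<Sum>i=1..K. \<alpha> i * gaussian_density (\<mu> i) (S i) x))) D"
    by (simp add: emeasure_density)
  finally show "emeasure (gmm K \<alpha> \<mu> S) D = \<dots>" .
qed simp

text \<open>The joint law of the index and the state. Conditioning writes the probability as the
  integral of the weight over \<open>D\<close> against the law of \<open>X\<close>; the density of
  that law is the denominator of the weight, so only the \<open>i\<close>-th term survives.\<close>

lemma has_gmm_law_component:
  fixes X :: "'w \<Rightarrow> real^'n"
  assumes "prob_space M"
    and law: "has_gmm_law M X K \<alpha> \<mu> S"
    and pd: "\<And>i. i \<in> {1..K} \<Longrightarrow> pos_def (S i)"
    and index: "I \<in> measurable M (count_space {1..K})"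
    and cond: "AE \<omega> in M. real_cond_exp M (vimage_algebra (space M) X borel)
        (indicator {\<omega> \<in> space M. I \<omega> = i}) \<omega> = gmm_weight K \<alpha> \<mu> S i (X \<omega>)"
    and i: "i \<in> {1..K}" and D: "D \<in> sets borel"
  shows "emeasure M {\<omega> \<in> space M. I \<omega> = i \<and> X \<omega> \<in> D} = ennreal (\<alpha> i) * emeasure (gaussian (\<mu> i) (S i)) D"
proof -
  interpret prob_space M by fact
  let ?F = "vimage_algebra (space M) X borel"
  let ?J = "{\<omega> \<in> space M. I \<omega> = i}"
  let ?f = "\<lambda>j. gaussian_density (\<mu> j) (S j)"
  let ?w = "gmm_weight K \<alpha> \<mu> S i"
  have X [measurable]: "X \<in> borel_measurable M" and dX: "distr M borel X = gmm K \<alpha> \<mu> S"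
    and nn: "\<And>j. j \<in> {1..K} \<Longrightarrow> 0 \<le> \<alpha> j" and sum1: "(\<Sum>j=1..K. \<alpha> j) = 1"
    using law by (auto simp: has_gmm_law_def)
  note [measurable] = D
  have fpos: "0 < ?f j x" if "j \<in> {1..K}" for j x
    using gaussian_density_pos[OF pd[OF that]] .
  \<comment> \<open>The weights sum to 1, so one of them is positive, and Gaussian densities vanish
    nowhere. Hence \<open>gmm_weight\<close> never divides by zero.\<close>
  have denom: "0 < (\<Sum>j=1..K. \<alpha> j * ?f j x)" for x
  proof -
    obtain j where j: "j \<in> {1..K}" "\<alpha> j \<noteq> 0"
      using sum1 by (metis sum.neutral zero_neq_one)
    show ?thesis
      using j nn fpos by (intro sum_pos2[of _ j]) (auto intro!: mult_nonneg_nonneg mult_pos_pos simp: less_imp_le order_less_le)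
  qed
  have w_nn: "0 \<le> ?w x" for x
    using nn[OF i] fpos[OF i, of x] denom[of x] by (simp add: gmm_weight_def less_imp_le)
  have [measurable]: "?w \<in> borel_measurable borel"
    unfolding gmm_weight_def by measurable
  have J [measurable]: "?J \<in> sets M"
    using measurable_sets[OF index, of "{i}"] i by (simp add: vimage_def Int_def conj_commute)
  have "subalgebra M ?F"
    unfolding subalgebra_def using X by (simp add: sets_image_in_sets)
  then interpret finite_measure_subalgebra M ?F
    by unfold_locales
  have DF: "X -` D \<inter> space M \<in> sets ?F"
    using D by (rule in_vimage_algebra)
  have w_le: "?w x \<le> 1" for x
  proof -
    have "\<alpha> i * ?f i x \<le> (\<Sum>j=1..K. \<alpha> j * ?f j x)"
      using i nn fpos by (intro member_le_sum) (auto intro!: mult_nonneg_nonneg simp: less_imp_le)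
    then show ?thesis using denom[of x] by (simp add: gmm_weight_def)
  qed
  \<comment> \<open>Conditional expectations are handled by Bochner integrals, densities by
    nonnegative integrals. Boundedness of the weight permits the passage from one to the
    other.\<close>
  have int_w: "integrable M (\<lambda>\<omega>. indicator D (X \<omega>) * ?w (X \<omega>))"
    using w_nn w_le by (intro integrable_const_bound[where B = 1] AE_I2) (auto simp: indicator_def)
  have "{\<omega> \<in> space M. I \<omega> = i \<and> X \<omega> \<in> D} = (X -` D \<inter> space M) \<inter> ?J" by auto
  then have ev: "{\<omega> \<in> space M. I \<omega> = i \<and> X \<omega> \<in> D} \<in> sets M"
    using measurable_sets[OF X D] J by simp
  have "emeasure M {\<omega> \<in> space M. I \<omega> = i \<and> X \<omega> \<in> D} =
      ennreal (\<integral>\<omega>. indicat_real {\<omega> \<in> space M. I \<omega> = i \<and> X \<omega> \<in> D} \<omega> \<partial>M)"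
    using ev by (simp add: emeasure_eq_measure)
  also have "(\<integral>\<omega>. indicat_real {\<omega> \<in> space M. I \<omega> = i \<and> X \<omega> \<in> D} \<omega> \<partial>M) =
      (\<integral>\<omega>. indicator D (X \<omega>) * indicat_real ?J \<omega> \<partial>M)"
    by (intro Bochner_Integration.integral_cong) (auto simp: indicator_def)
  also have "(\<integral>\<omega>. indicator D (X \<omega>) * indicat_real ?J \<omega> \<partial>M) = (\<integral>\<omega>\<in>X -` D \<inter> space M. indicat_real ?J \<omega> \<partial>M)"
    unfolding set_lebesgue_integral_def by (intro Bochner_Integration.integral_cong) (auto simp: indicator_def)
  \<comment> \<open>The defining property of conditional expectation applies because the event that
    \<open>X\<close> lies in \<open>D\<close> belongs to the sigma-algebra generated by
    \<open>X\<close>.\<close>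
  also have "\<dots> = (\<integral>\<omega>\<in>X -` D \<inter> space M. real_cond_exp M ?F (indicator ?J) \<omega> \<partial>M)"
    by (rule real_cond_exp_intA[OF _ DF]) (simp add: emeasure_eq_measure)
  also have "\<dots> = (\<integral>\<omega>. indicator D (X \<omega>) * ?w (X \<omega>) \<partial>M)"
    unfolding set_lebesgue_integral_def
  proof (rule integral_cong_AE)
    show "AE \<omega> in M. indicat_real (X -` D \<inter> space M) \<omega> *\<^sub>R real_cond_exp M ?F (indicator ?J) \<omega> =
        indicator D (X \<omega>) * ?w (X \<omega>)"
      using cond AE_space by eventually_elim (auto simp: indicator_def)
  qed measurable
  also have "ennreal (\<integral>\<omega>. indicator D (X \<omega>) * ?w (X \<omega>) \<partial>M) = (\<integral>\<^sup>+\<omega>. ennreal (indicator D (X \<omega>) * ?w (X \<omega>)) \<partial>M)"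
    using w_nn by (intro nn_integral_eq_integral[symmetric] int_w AE_I2) simp
  also have "\<dots> = (\<integral>\<^sup>+x. ennreal (indicator D x * ?w x) \<partial>distr M borel X)"
    by (subst nn_integral_distr) simp_all
  also have "\<dots> = (\<integral>\<^sup>+x. ennreal (\<Sum>j=1..K. \<alpha> j * ?f j x) * ennreal (indicator D x * ?w x) \<partial>lborel)"
  proof -
    have "gmm K \<alpha> \<mu> S = density lborel (\<lambda>x. ennreal (\<Sum>j=1..K. \<alpha> j * ?f j x))"
      using pd nn by (rule gmm_eq_density)
    then show ?thesis
      unfolding dX by (simp add: nn_integral_density)
  qed
  also have "\<dots> = (\<integral>\<^sup>+x. ennreal (\<alpha> i) * (ennreal (?f i x) * indicator D x) \<partial>lborel)"
  proof (rule nn_integral_cong)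
    fix x
    have "(\<Sum>j=1..K. \<alpha> j * ?f j x) * ?w x = \<alpha> i * ?f i x"
      using denom[of x] by (simp add: gmm_weight_def)
    then show "ennreal (\<Sum>j=1..K. \<alpha> j * ?f j x) * ennreal (indicator D x * ?w x) =
        ennreal (\<alpha> i) * (ennreal (?f i x) * indicator D x)"
      using denom[of x] nn[OF i] w_nn[of x] fpos[OF i, of x]
      by (auto simp: indicator_def simp flip: ennreal_mult)
  qed
  also have "\<dots> = ennreal (\<alpha> i) * emeasure (gaussian (\<mu> i) (S i)) D"
    by (simp add: nn_integral_cmult gaussian_eq_density[OF pd[OF i]] emeasure_density)
  finally show ?thesis .
qed

text \<open>The event that \<open>Y\<close> lies in \<open>D\<close> splits according to the value
  of \<open>I\<close>. On each piece \<open>Y\<close> is one fixed affine function of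
  \<open>X\<close>, so the piece has the mass of an affine image of the corresponding
  Gaussian.\<close>

lemma has_gmm_law_switched_affine:
  fixes X Y :: "'w \<Rightarrow> real^'n"
  assumes M: "prob_space M"
    and law: "has_gmm_law M X K \<alpha> \<mu> S"
    and pd: "\<And>i. i \<in> {1..K} \<Longrightarrow> pos_def (S i)"
    and index: "I \<in> measurable M (count_space {1..K})"
    and cond: "\<And>i. i \<in> {1..K} \<Longrightarrow> AE \<omega> in M. real_cond_exp M (vimage_algebra (space M) X borel)
        (indicator {\<omega> \<in> space M. I \<omega> = i}) \<omega> = gmm_weight K \<alpha> \<mu> S i (X \<omega>)"
    and Y: "\<And>\<omega>. \<omega> \<in> space M \<Longrightarrow> Y \<omega> = m (I \<omega>) + C (I \<omega>) *v (X \<omega> - \<mu> (I \<omega>))"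
  shows "has_gmm_law M Y K \<alpha> m (\<lambda>i. C i ** S i ** transpose (C i))"
proof -
  have X [measurable]: "X \<in> borel_measurable M"
    using law by (simp add: has_gmm_law_def)
  let ?g = "\<lambda>i x. m i + C i *v (x - \<mu> i)"
  have g [measurable]: "?g i \<in> borel_measurable borel" for i
    by measurable
  have "(\<lambda>\<omega>. ?g (I \<omega>) (X \<omega>)) \<in> borel_measurable M"
    by (rule measurable_compose_countable'[OF _ index]) auto
  then have Ym [measurable]: "Y \<in> borel_measurable M"
    by (simp add: Y cong: measurable_cong)
  have "distr M borel Y = gmm K \<alpha> m (\<lambda>i. C i ** S i ** transpose (C i))"
  proof (rule measure_eqI)
    fix D assume "D \<in> sets (distr M borel Y)"
    then have D [measurable]: "D \<in> sets borel" by simp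
    have part: "{\<omega> \<in> space M. I \<omega> = i \<and> X \<omega> \<in> ?g i -` D} \<in> sets M" if "i \<in> {1..K}" for i
    proof -
      have "{\<omega> \<in> space M. I \<omega> = i} \<in> sets M"
        using measurable_sets[OF index, of "{i}"] that by (simp add: vimage_def Int_def conj_commute)
      moreover have "{\<omega> \<in> space M. X \<omega> \<in> ?g i -` D} \<in> sets M"
        using measurable_sets[OF measurable_compose[OF X g[of i]] D] by (simp add: vimage_def Int_def conj_commute)
      moreover have "{\<omega> \<in> space M. I \<omega> = i \<and> X \<omega> \<in> ?g i -` D} =
          {\<omega> \<in> space M. I \<omega> = i} \<inter> {\<omega> \<in> space M. X \<omega> \<in> ?g i -` D}" by auto
      ultimately show ?thesis by simp
    qed
    have "emeasure (distr M borel Y) D = emeasure M (\<Union>i\<in>{1..K}. {\<omega> \<in> space M. I \<omega> = i \<and> X \<omega> \<in> ?g i -` D})"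
      using measurable_space[OF index] by (subst emeasure_distr) (auto simp: Y intro!: arg_cong[where f = "emeasure M"])
    also have "\<dots> = (\<Sum>i=1..K. emeasure M {\<omega> \<in> space M. I \<omega> = i \<and> X \<omega> \<in> ?g i -` D})"
      using part by (intro sum_emeasure[symmetric]) (auto simp: disjoint_family_on_def)
    also have "\<dots> = (\<Sum>i=1..K. ennreal (\<alpha> i) * emeasure (gaussian (m i) (C i ** S i ** transpose (C i))) D)"
    proof (rule sum.cong)
      fix i assume i: "i \<in> {1..K}"
      have vD: "?g i -` D \<in> sets borel"
        using measurable_sets[OF g[of i] D] by simp
      have "emeasure M {\<omega> \<in> space M. I \<omega> = i \<and> X \<omega> \<in> ?g i -` D} =
          ennreal (\<alpha> i) * emeasure (gaussian (\<mu> i) (S i)) (?g i -` D)"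
        by (rule has_gmm_law_component[OF M law pd index cond[OF i] i vD])
      also have "emeasure (gaussian (\<mu> i) (S i)) (?g i -` D) =
          emeasure (distr (gaussian (\<mu> i) (S i)) borel (?g i)) D"
        by (subst emeasure_distr) (simp_all add: gaussian_def)
      finally show "emeasure M {\<omega> \<in> space M. I \<omega> = i \<and> X \<omega> \<in> ?g i -` D} =
          ennreal (\<alpha> i) * emeasure (gaussian (m i) (C i ** S i ** transpose (C i))) D"
        by (simp add: gaussian_affine[OF pd[OF i]])
    qed simp
    finally show "emeasure (distr M borel Y) D = emeasure (gmm K \<alpha> m (\<lambda>i. C i ** S i ** transpose (C i))) D"
      by (simp add: emeasure_gmm)
  qed simp
  then show ?thesis
    using law by (simp add: has_gmm_law_def pos_semidef_congruence)
qed

section \<open>Solution of the stacked linear system\<close>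

lemma block_sel_sum:
  fixes F' :: "nat \<Rightarrow> real^'c^'d"
  shows "k < p \<Longrightarrow> block_row_vec p (block_sel k) x = x k"
  "k < p \<Longrightarrow> block_row_col p (block_sel k) F = F k"
  "k < p \<Longrightarrow> block_row_col p F' (block_transpose (block_sel k)) = F' k"
proof -
  have "transpose (0 :: real^'c^'c) = 0" by (simp add: transpose_def vec_eq_iff)
  then show "k < p \<Longrightarrow> block_row_vec p (block_sel k) x = x k"
    "k < p \<Longrightarrow> block_row_col p (block_sel k) F = F k"
    "k < p \<Longrightarrow> block_row_col p F' (block_transpose (block_sel k)) = F' k"
    by (simp_all add: block_row_vec_def block_row_col_def block_transpose_def block_sel_def
        if_distrib[of "\<lambda>M. M *v _"] if_distrib[of "\<lambda>M. M ** _"] if_distrib[of transpose]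
        if_distrib[of "(**) _"] cong: if_cong)
qed

lemma state_cov_eq:
  assumes "k \<le> N"
  shows "state_cov N A B L S k = closed_loop N A B L k ** S ** transpose (closed_loop N A B L k)"
  using assms by (simp add: state_cov_def block_sel_sum) (simp add: block_transpose_def)

lemma linear_system_solution:
  fixes A :: "nat \<Rightarrow> real^'n^'n" and B :: "nat \<Rightarrow> real^'m^'n"
  assumes "\<And>k. k < N \<Longrightarrow> x (Suc k) = A k *v x k + B k *v u k" and "k \<le> N"
  shows "x k = stacked_A A k *v x 0 + block_mat_vec N (stacked_B A B) u k"
proof -
  \<comment> \<open>The blocks of \<open>stacked_B\<close> with \<open>l \<ge> k\<close> vanish.
    Since \<open>k \<le> N\<close>, the sum over all \<open>N\<close> controls contains every
    remaining term.\<close>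
  have trunc: "block_mat_vec N (stacked_B A B) u k = (\<Sum>l<k. transition A (Suc l) k *v (B l *v u l))"
    if "k \<le> N" for k
    unfolding block_mat_vec_def stacked_B_def using that
    by (intro sum.mono_neutral_cong_right) (auto simp: matrix_vector_mul_assoc)
  show ?thesis
    using \<open>k \<le> N\<close>
  proof (induction k)
    case 0
    then show ?case by (simp add: stacked_A_def trunc)
  next
    case (Suc k)
    \<comment> \<open>These are the terms already present at time \<open>k\<close>. The new term
      \<open>l = k\<close> carries the empty transition product, the identity, and contributes the
      current input.\<close>
    have "(\<Sum>l<k. transition A (Suc l) (Suc k) *v (B l *v u l)) =
        A k *v (\<Sum>l<k. transition A (Suc l) k *v (B l *v u l))"
      by (simp add: linear_sum[OF matrix_vector_mul_linear] matrix_vector_mul_assoc matrix_mul_assoc)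
    then show ?case
      using Suc assms(1)[of k]
      by (simp add: trunc stacked_A_def matrix_vector_right_distrib matrix_vector_mul_assoc add.assoc)
  qed
qed

text \<open>A statement about a single trajectory with fixed gains. The centre \<open>\<mu>\<close>
  is arbitrary: its contributions to \<open>state_mean\<close> and to the closed-loop term cancel.
  It can thus be taken to be the mean of whichever component was drawn.\<close>

lemma state_affine_in_initial:
  fixes A :: "nat \<Rightarrow> real^'n^'n" and B :: "nat \<Rightarrow> real^'m^'n"
  assumes "\<And>k. k < N \<Longrightarrow> x (Suc k) = A k *v x k + B k *v (v k + L k *v (x 0 - \<mu>g))" and "k \<le> N"
  shows "x k = state_mean N A B v L \<mu> \<mu>g k + closed_loop N A B L k *v (x 0 - \<mu>)"
proof -
  let ?G = "block_mat_col N (stacked_B A B) L k"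
  have "block_mat_vec N (stacked_B A B) (\<lambda>l. v l + L l *v y) k =
      block_mat_vec N (stacked_B A B) v k + ?G *v y" for y
    unfolding block_mat_vec_def block_mat_col_def
    by (induction N) (simp_all add: matrix_vector_right_distrib matrix_vector_mult_add_rdistrib matrix_vector_mul_assoc)
  then have "x k = stacked_A A k *v x 0 + block_mat_vec N (stacked_B A B) v k + ?G *v (x 0 - \<mu>g)"
    using linear_system_solution[of N x A B "\<lambda>l. v l + L l *v (x 0 - \<mu>g)" k] assms by simp
  then show ?thesis
    using assms(2)
    by (simp add: state_mean_def block_sel_sum closed_loop_def matrix_vector_mult_add_rdistrib
        matrix_vector_mult_diff_distrib)
qed

theorem proposition3:
  fixes M :: "'w measure"
    and x :: "nat \<Rightarrow> 'w \<Rightarrow> real^'nx" and u :: "nat \<Rightarrow> 'w \<Rightarrow> real^'nu" and I :: "'w \<Rightarrow> nat"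
    and A :: "nat \<Rightarrow> real^'nx^'nx" and B :: "nat \<Rightarrow> real^'nu^'nx"
    and v :: "nat \<Rightarrow> real^'nu" and L :: "nat \<Rightarrow> nat \<Rightarrow> real^'nx^'nu"
    and \<alpha> :: "nat \<Rightarrow> real" and \<mu>0 :: "nat \<Rightarrow> real^'nx" and \<Sigma>0 :: "nat \<Rightarrow> real^'nx^'nx"
    and N K :: nat
  assumes "prob_space M"
    and init: "has_gmm_law M (x 0) K \<alpha> \<mu>0 \<Sigma>0"
    and pd: "\<And>i. i \<in> {1..K} \<Longrightarrow> pos_def (\<Sigma>0 i)"
    and index: "I \<in> measurable M (count_space {1..K})"
    and index_law: "\<And>i. i \<in> {1..K} \<Longrightarrow>
      AE \<omega> in M. real_cond_exp M (vimage_algebra (space M) (x 0) borel)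
                   (indicator {\<omega> \<in> space M. I \<omega> = i}) \<omega> = gmm_weight K \<alpha> \<mu>0 \<Sigma>0 i (x 0 \<omega>)"
    and control: "\<And>k \<omega>. k < N \<Longrightarrow> \<omega> \<in> space M \<Longrightarrow>
      u k \<omega> = v k + L k (I \<omega>) *v (x 0 \<omega> - gmm_mean K \<alpha> \<mu>0)"
    and dynamics: "\<And>k \<omega>. k < N \<Longrightarrow> \<omega> \<in> space M \<Longrightarrow>
      x (Suc k) \<omega> = A k *v x k \<omega> + B k *v u k \<omega>"
  shows "\<forall>k\<le>N. has_gmm_law M (x k) K \<alpha>
           (\<lambda>i. state_mean N A B v (\<lambda>l. L l i) (\<mu>0 i) (gmm_mean K \<alpha> \<mu>0) k)
           (\<lambda>i. state_cov N A B (\<lambda>l. L l i) (\<Sigma>0 i) k)"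
proof (intro allI impI)
  fix k assume k: "k \<le> N"
  let ?\<mu>g = "gmm_mean K \<alpha> \<mu>0"
  \<comment> \<open>For a fixed outcome the same index is used at all times, so the gains are those
    of one component, and its initial mean serves as the centre.\<close>
  have "x k \<omega> = state_mean N A B v (\<lambda>l. L l (I \<omega>)) (\<mu>0 (I \<omega>)) ?\<mu>g k +
      closed_loop N A B (\<lambda>l. L l (I \<omega>)) k *v (x 0 \<omega> - \<mu>0 (I \<omega>))" if "\<omega> \<in> space M" for \<omega>
    using dynamics[OF _ that] control[OF _ that]
    by (intro state_affine_in_initial[where x = "\<lambda>k. x k \<omega>"] k) simp
  then show "has_gmm_law M (x k) K \<alpha> (\<lambda>i. state_mean N A B v (\<lambda>l. L l i) (\<mu>0 i) ?\<mu>g k)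
      (\<lambda>i. state_cov N A B (\<lambda>l. L l i) (\<Sigma>0 i) k)"
    unfolding state_cov_eq[OF k]
    by (intro has_gmm_law_switched_affine[OF \<open>prob_space M\<close> init pd index index_law])
qed

end
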